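(* Let $U:\mathbb R^d\to\mathbb R$ be differentiable, strongly convex, with Lipschitz gradient, and let $h,\gamma>0$. Let $(X_k,V_k)_{k\ge0}$ be the OBABO chain for $U$ with step size $h$ and friction $\gamma$, where the update from $(X_k,V_k)$ to $(X_{k+1},V_{k+1})$ uses the Gaussian pair $(\xi_{k+1}^{(1)},\xi_{k+1}^{(2)})$. Let $\xi_0^{(2)}$ be a $\mathcal N(0,\mathrm{Id}_d)$ variable independent of the pairs $(\xi_k^{(1)},\xi_k^{(2)})_{k\ge1}$ driving the chain; alternatively, let $\xi_0^{(2)}$ be the zero vector. Define the auxiliary variable $X_{-1}$ by $$V_0=r\left(\frac{X_0-X_{-1}}h-\frac h2\nabla U(X_0)\right)+\sigma\xi_0^{(2)} .$$ Then, for every $k\ge0$, $$X_{k+1}=X_k+\beta(X_k-X_{k-1})-s\nabla U(X_k)+\zeta_{k+1},\qquad s=\frac{h^2}{2}(1+\beta),$$ where $$\zeta_{k+1}=h\sigma\bigl(r\xi_k^{(2)}+\xi_{k+1}^{(1)}\bigr).$$ Distinct $\zeta_k$ ($k\ge1$) depend on disjoint noises and are therefore independent centered Gaussians. If $\xi_0^{(2)}\sim\mathcal N(0,\mathrm{Id}_d)$, they are identically distributed with covariance $$\mathbb E[\zeta_k\zeta_k^\top]=h^2(1-\beta^2)\,\mathrm{Id}_d .$$ If $\xi_0^{(2)}=0$, then $\zeta_1=h\sigma\xi_1^{(1)}$ with $\mathbb E[\zeta_1\zeta_1^\top]=h^2(1-\beta)\,\mathrm{Id}_d$, while $\mathbb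 E[\zeta_k\zeta_k^\top]=h^2(1-\beta^2)\,\mathrm{Id}_d$ holds for every $k\ge2$.
   Context: Notation: $r=e^{-\gamma h/2}$, $\beta=r^2=e^{-\gamma h}$, $\sigma=(1-\beta)^{1/2}$. One OBABO step maps $(x,v)\in\mathbb R^d\times\mathbb R^d$ to $(x^+,v^+)$ by $v^{(a)}=rv+\sigma\xi^{(1)}$, $v^{(b)}=v^{(a)}-\frac h2\nabla U(x)$, $x^+=x+hv^{(b)}$, $v^{(c)}=v^{(b)}-\frac h2\nabla U(x^+)$, $v^+=rv^{(c)}+\sigma\xi^{(2)}$, where $\xi^{(1)},\xi^{(2)}$ are independent $\mathcal N(0,\mathrm{Id}_d)$. The chain is obtained by iterating with i.i.d. copies $(\xi_k^{(1)},\xi_k^{(2)})$, $k\ge1$, of the pair. *)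

theory Defs
  imports "HOL-Probability.Probability"
begin

definition strongly_convex :: "('a::real_normed_vector \<Rightarrow> real) \<Rightarrow> bool" where
  "strongly_convex f \<longleftrightarrow>
     (\<exists>m>0. \<forall>x y. \<forall>t\<in>{0..1}.
        f (t *\<^sub>R x + (1 - t) *\<^sub>R y)
          \<le> t * f x + (1 - t) * f y - m / 2 * t * (1 - t) * (norm (x - y))\<^sup>2)"

text \<open>The law N(0, Id) on \<open>real ^ 'n\<close>; the product below is
  \<open>(2 * pi) powr (- d / 2) * exp (- (norm x)\<^sup>2 / 2)\<close> with \<open>d = CARD('n)\<close>.\<close>

definition std_normal_vector :: "'w measure \<Rightarrow> ('w \<Rightarrow> real ^ 'n) \<Rightarrow> bool" where
  "std_normal_vector M \<xi> \<longleftrightarrow>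
     distributed M lborel \<xi> (\<lambda>x. ennreal (\<Prod>i\<in>UNIV. std_normal_density (x $ i)))"

text \<open>Gaussian vectors with arbitrary mean and covariance: every linear functional is
  univariate normal. The case \<open>s = 0\<close> is separated because \<open>normal_density m 0\<close>
  is not the density of the point mass at \<open>m\<close>.\<close>

definition gaussian_vector :: "'w measure \<Rightarrow> ('w \<Rightarrow> 'a::euclidean_space) \<Rightarrow> bool" where
  "gaussian_vector M Z \<longleftrightarrow>
     Z \<in> borel_measurable M \<and>
     (\<forall>u. \<exists>m s. 0 \<le> s \<and>
        distr M borel (\<lambda>\<omega>. u \<bullet> Z \<omega>) =
          (if s = 0 then return borel m
           else density lborel (\<lambda>x. ennreal (normal_density m s x))))"

text \<open>One OBABO step for the gradient field \<open>g\<close>, driven by the noise pair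
  \<open>(\<xi>1, \<xi>2)\<close>.\<close>

definition obabo_step ::
  "('a::real_vector \<Rightarrow> 'a) \<Rightarrow> real \<Rightarrow> real \<Rightarrow> 'a \<times> 'a \<Rightarrow> 'a \<times> 'a \<Rightarrow> 'a \<times> 'a" where
  "obabo_step g h \<gamma> = (\<lambda>(\<xi>1, \<xi>2) (x, v).
     let r = exp (- \<gamma> * h / 2);
         \<sigma> = sqrt (1 - r\<^sup>2);
         va = r *\<^sub>R v + \<sigma> *\<^sub>R \<xi>1;
         vb = va - (h / 2) *\<^sub>R g x;
         x' = x + h *\<^sub>R vb;
         vc = vb - (h / 2) *\<^sub>R g x';
         v' = r *\<^sub>R vc + \<sigma> *\<^sub>R \<xi>2
     in (x', v'))"

end

theory Submission
  imports Defs
begin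

text \<open>
  The recursion is pure algebra. The second half of each OBABO step writes the velocity as
  \<open>r\<close> times a displacement term plus fresh noise:
  \<open>V k = r (h\<inverse> (X k - X (k - 1)) - h/2 \<nabla>U (X k)) + \<sigma> \<xi>2 k\<close>. For \<open>k \<ge> 1\<close> this holds because
  \<open>X k - X (k - 1)\<close> is \<open>h\<close> times the velocity used for the drift; for \<open>k = 0\<close> it is the equation that
  defines \<open>X (-1)\<close>. Substituting it into the next position update eliminates the velocities
  (\<open>obabo_three_term_recursion\<close>) and leaves exactly the noise terms \<open>r \<xi>2 k + \<xi>1 (k + 1)\<close>.

  For the law of these terms the noises have to be regrouped: \<open>\<zeta> k\<close> takes \<open>\<xi>2\<close> from one pair and
  \<open>\<xi>1\<close> from the next. Independence of the pairs, independence within each pair, and independence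
  of \<open>\<xi>2 0\<close> from the pairs together make all the individual noises mutually independent
  (\<open>indep_vars_split_pairs\<close>, \<open>indep_vars_insert\<close>), and an independent family may be regrouped
  along any disjoint blocks, here \<open>{\<xi>2 (k - 1), \<xi>1 k}\<close>.

  Every \<open>\<zeta> k\<close> is then a scaled sum of two independent vectors with laws of the form \<open>N(0, v Id)\<close>,
  where \<open>v = 0\<close> covers a vanishing initial noise. Such laws (\<open>isotropic_gaussian\<close>) are determined by
  their characteristic functions, under which scaling and independent sums become arithmetic on \<open>v\<close>.
  The variance of \<open>\<zeta> k\<close> is \<open>h\<^sup>2 \<sigma>\<^sup>2 (r\<^sup>2 v + 1)\<close> with \<open>v\<close> that of \<open>\<xi>2 (k - 1)\<close>. Since
  \<open>\<sigma>\<^sup>2 = 1 - \<beta>\<close> and \<open>r\<^sup>2 = \<beta>\<close>, this is \<open>h\<^sup>2 (1 - \<beta>\<^sup>2)\<close> for \<open>v = 1\<close> and \<open>h\<^sup>2 (1 - \<beta>)\<close> for \<open>v = 0\<close>.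
\<close>

section \<open>Extending and refining independent families\<close>

context prob_space begin

lemma indep_vars_cong_space:
  assumes "indep_vars N X I" and eq: "\<And>i \<omega>. i \<in> I \<Longrightarrow> \<omega> \<in> space M \<Longrightarrow> X i \<omega> = Y i \<omega>"
  shows "indep_vars N Y I"
proof -
  have "random_variable (N i) (X i) \<longleftrightarrow> random_variable (N i) (Y i)" if "i \<in> I" for i
    using eq[OF that] by (rule measurable_cong)
  moreover have "X i -` A \<inter> space M = Y i -` A \<inter> space M" if "i \<in> I" for i A
    using eq[OF that] by auto
  ultimately show ?thesis
    using assms(1) unfolding indep_vars_def2 by (simp cong: indep_sets_cong)
qed

text \<open>A constant generates the trivial \<open>\<sigma>\<close>-algebra, whose events have probability 0 or 1.\<close>

lemma indep_set_vimage_const: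
  assumes const: "\<And>\<omega>. \<omega> \<in> space M \<Longrightarrow> X \<omega> = c" and c: "c \<in> space S" and G: "G \<subseteq> events"
  shows "indep_set (sets (vimage_algebra (space M) X S)) G"
proof -
  have X: "random_variable S X"
    using c by (subst measurable_cong[where g = "\<lambda>_. c"]) (auto simp: const)
  have triv: "X -` A \<inter> space M = {} \<or> X -` A \<inter> space M = space M" for A
    using const by (cases "c \<in> A") auto
  have "prob (a \<inter> b) = prob a * prob b"
    if a: "a \<in> sets (vimage_algebra (space M) X S)" and b: "b \<in> G" for a b
  proof -
    have "X \<in> space M \<rightarrow> space S" using X by (auto dest: measurable_space)
    then obtain A where "a = X -` A \<inter> space M" using a by (auto simp: sets_vimage_algebra2)
    moreover have "b \<subseteq> space M" using b G sets.sets_into_space by auto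
    ultimately show ?thesis
      using triv[of A] by (auto simp: Int_absorb1 prob_space)
  qed
  moreover have "sets (vimage_algebra (space M) X S) \<subseteq> events"
    using X by (auto simp: measurable_iff_sets)
  ultimately show ?thesis using G by (auto simp: indep_sets2_eq)
qed

text \<open>The event that the members of a finite \<open>K \<subseteq> I\<close> satisfy given constraints is a cylinder event of the
  restricted family. The hypothesis on the new member therefore splits off its factor, and the
  old independence factors the rest. The hypothesis speaks of \<open>\<sigma>\<close>-algebras because
  \<^const>\<open>indep_var\<close> can only relate random variables with values in the same type.\<close>

lemma indep_vars_insert:
  assumes indep: "indep_vars N X I" and new: "i \<notin> I"
    and rv_new: "random_variable (N i) (X i)"
    and past: "indep_set (sets (vimage_algebra (space M) (X i) (N i)))
      (sets (vimage_algebra (space M) (\<lambda>\<omega>. \<lambda>j\<in>I. X j \<omega>) (PiM I N)))"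
  shows "indep_vars N X (insert i I)"
proof -
  have rv: "random_variable (N j) (X j)" if "j \<in> insert i I" for j
    using indep rv_new that by (auto simp: indep_vars_def)
  have "indep_sets (\<lambda>j. {X j -` B \<inter> space M |B. B \<in> sets (N j)}) (insert i I)"
  proof (rule indep_setsI)
    show "{X j -` B \<inter> space M |B. B \<in> sets (N j)} \<subseteq> events" if "j \<in> insert i I" for j
      using rv[OF that] by (auto intro: measurable_sets)
  next
    fix A J assume J: "J \<noteq> {}" "J \<subseteq> insert i I" "finite J"
      and "\<forall>j\<in>J. A j \<in> {X j -` B \<inter> space M |B. B \<in> sets (N j)}"
    then have "\<forall>j\<in>J. \<exists>B. B \<in> sets (N j) \<and> A j = X j -` B \<inter> space M"
      by blast
    from bchoice[OF this] obtain B where B: "\<And>j. j \<in> J \<Longrightarrow> B j \<in> sets (N j)"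
        and A: "\<And>j. j \<in> J \<Longrightarrow> A j = X j -` B j \<inter> space M"
      by blast
    define K where "K = J - {i}"
    have K: "K \<subseteq> I" "finite K" "K \<subseteq> J" using J by (auto simp: K_def)
    have prod_K: "prob (\<Inter>j\<in>K. A j) = (\<Prod>j\<in>K. prob (A j))" if "K \<noteq> {}"
    proof -
      have "prob (\<Inter>j\<in>K. X j -` B j \<inter> space M) = (\<Prod>j\<in>K. prob (X j -` B j \<inter> space M))"
        using that K B by (intro indep_varsD[OF indep]) auto
      moreover have "A j = X j -` B j \<inter> space M" if "j \<in> K" for j
        using A that K by auto
      ultimately show ?thesis by simp
    qed
    show "prob (\<Inter>j\<in>J. A j) = (\<Prod>j\<in>J. prob (A j))"
    proof (cases "i \<in> J \<and> K \<noteq> {}")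
      case True
      let ?past = "\<lambda>\<omega>. \<lambda>j\<in>I. X j \<omega>" and ?C = "prod_emb I N K (Pi\<^sub>E K B)"
      have J_eq: "J = insert i K" using True by (auto simp: K_def)
      have C: "?C \<in> sets (PiM I N)"
        using K B by (intro sets_PiM_I) auto
      have "\<omega> \<in> ?past -` ?C \<longleftrightarrow> (\<forall>j\<in>K. X j \<omega> \<in> B j)" if "\<omega> \<in> space M" for \<omega>
        using K rv[THEN measurable_space, OF _ that]
        by (auto simp: prod_emb_iff PiE_iff extensional_def subset_eq)
      then have "?past -` ?C \<inter> space M = {\<omega>\<in>space M. \<forall>j\<in>K. X j \<omega> \<in> B j}"
        by blast
      also have "\<dots> = (\<Inter>j\<in>K. X j -` B j \<inter> space M)"
        using True by blast
      also have "\<dots> = (\<Inter>j\<in>K. A j)"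
        using A K by (intro INF_cong) auto
      finally have past_eq: "?past -` ?C \<inter> space M = (\<Inter>j\<in>K. A j)" .
      have "(\<Inter>j\<in>J. A j) = (X i -` B i \<inter> space M) \<inter> (?past -` ?C \<inter> space M)"
        using past_eq True A[of i] by (auto simp: J_eq)
      also have "prob \<dots> = prob (X i -` B i \<inter> space M) * prob (?past -` ?C \<inter> space M)"
      proof -
        have "X i -` B i \<inter> space M \<in> sets (vimage_algebra (space M) (X i) (N i))"
          using True B by (intro in_vimage_algebra) simp
        moreover have "?past -` ?C \<inter> space M \<in> sets (vimage_algebra (space M) ?past (PiM I N))"
          using C by (rule in_vimage_algebra)
        ultimately show ?thesis
          using past unfolding indep_sets2_eq by blast
      qed
      also have "\<dots> = prob (A i) * (\<Prod>j\<in>K. prob (A j))"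
        using past_eq prod_K True A by simp
      also have "\<dots> = (\<Prod>j\<in>J. prob (A j))"
        using K by (subst J_eq, subst prod.insert) (auto simp: K_def)
      finally show ?thesis .
    next
      case False
      then have "J = {i} \<or> J = K" using J by (auto simp: K_def)
      then show ?thesis
        using prod_K J by auto
    qed
  qed
  with rv show ?thesis by (simp add: indep_vars_def2)
qed

text \<open>The probability of a product event factors first over the pairs and then within each pair.\<close>

lemma indep_vars_split_pairs:
  assumes pairs: "indep_vars (\<lambda>_. N \<Otimes>\<^sub>M N) (\<lambda>k \<omega>. (X k \<omega>, Y k \<omega>)) I"
    and within: "\<And>k. k \<in> I \<Longrightarrow> indep_var N (X k) N (Y k)"
  shows "indep_vars (\<lambda>_. N) (\<lambda>(k, b) \<omega>. if b then X k \<omega> else Y k \<omega>) (I \<times> UNIV)"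
proof -
  define Z where "Z = (\<lambda>(k, b) \<omega>. if b then X k \<omega> else Y k \<omega>)"
  have Z_simps: "Z (k, True) = X k" "Z (k, False) = Y k" for k
    by (auto simp: Z_def)
  have rv: "random_variable N (Z j)" if "j \<in> I \<times> UNIV" for j
    using that within by (cases j; cases "snd j") (auto simp: Z_simps dest: indep_var_rv1 indep_var_rv2)
  have "indep_sets (\<lambda>j. {Z j -` B \<inter> space M |B. B \<in> sets N}) (I \<times> UNIV)"
  proof (rule indep_setsI)
    show "{Z j -` B \<inter> space M |B. B \<in> sets N} \<subseteq> events" if "j \<in> I \<times> UNIV" for j
      using rv[OF that] by (auto intro: measurable_sets)
  next
    fix A J assume J: "J \<noteq> {}" "J \<subseteq> I \<times> UNIV" "finite J"
      and "\<forall>j\<in>J. A j \<in> {Z j -` B \<inter> space M |B. B \<in> sets N}"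
    then have "\<forall>j\<in>J. \<exists>B. B \<in> sets N \<and> A j = Z j -` B \<inter> space M"
      by blast
    from bchoice[OF this] obtain B where B: "\<And>j. j \<in> J \<Longrightarrow> B j \<in> sets N"
        and A: "\<And>j. j \<in> J \<Longrightarrow> A j = Z j -` B j \<inter> space M"
      by blast
    \<comment> \<open>Pad the constraints: a coordinate of a touched pair that is not in \<open>J\<close> is unconstrained.\<close>
    define C where "C j = (if j \<in> J then B j else space N)" for j
    have C: "C j \<in> sets N" for j using B by (auto simp: C_def)
    define K where "K = fst ` J"
    have K: "K \<noteq> {}" "finite K" "K \<subseteq> I" "J \<subseteq> K \<times> UNIV"
      using J by (force simp: K_def)+
    have Z_space: "Z j \<omega> \<in> space N" if "j \<in> K \<times> UNIV" "\<omega> \<in> space M" for j \<omega>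
      using rv[THEN measurable_space, of j \<omega>] that K by auto
    have "(\<Inter>j\<in>J. A j) = {\<omega>\<in>space M. \<forall>j\<in>J. Z j \<omega> \<in> B j}"
      using J A by auto
    also have "\<dots> = {\<omega>\<in>space M. \<forall>j\<in>K \<times> UNIV. Z j \<omega> \<in> C j}"
      using K Z_space by (auto simp: C_def)
    also have "\<dots> = (\<Inter>k\<in>K. (\<lambda>\<omega>. (X k \<omega>, Y k \<omega>)) -` (C (k, True) \<times> C (k, False)) \<inter> space M)"
      using K(1) by (auto simp: UNIV_bool Z_simps)
    also have "prob \<dots> = (\<Prod>k\<in>K. prob ((\<lambda>\<omega>. (X k \<omega>, Y k \<omega>)) -` (C (k, True) \<times> C (k, False)) \<inter> space M))"
      using K C by (intro indep_varsD[OF pairs]) auto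
    also have "\<dots> = (\<Prod>k\<in>K. \<Prod>b\<in>UNIV. prob (Z (k, b) -` C (k, b) \<inter> space M))"
    proof (rule prod.cong[OF refl])
      fix k assume "k \<in> K"
      then have "k \<in> I" using K by auto
      then show "prob ((\<lambda>\<omega>. (X k \<omega>, Y k \<omega>)) -` (C (k, True) \<times> C (k, False)) \<inter> space M) =
          (\<Prod>b\<in>UNIV. prob (Z (k, b) -` C (k, b) \<inter> space M))"
        using indep_varD[OF within, of k "C (k, True)" "C (k, False)"] C
        by (simp add: UNIV_bool Z_simps mult.commute)
    qed
    also have "\<dots> = (\<Prod>j\<in>K \<times> UNIV. prob (Z j -` C j \<inter> space M))"
      by (simp add: prod.cartesian_product case_prod_beta)
    also have "\<dots> = (\<Prod>j\<in>J. prob (A j))"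
    proof (rule prod.mono_neutral_cong_right)
      show "\<forall>j\<in>K \<times> UNIV - J. prob (Z j -` C j \<inter> space M) = 1"
      proof
        fix j assume j: "j \<in> K \<times> UNIV - J"
        then have "Z j -` C j \<inter> space M = space M"
          using Z_space[of j] by (auto simp: C_def)
        then show "prob (Z j -` C j \<inter> space M) = 1" by (simp add: prob_space)
      qed
    qed (use K in \<open>auto simp: C_def A\<close>)
    finally show "prob (\<Inter>j\<in>J. A j) = (\<Prod>j\<in>J. prob (A j))" .
  qed
  with rv show ?thesis by (simp add: indep_vars_def2 Z_def)
qed

end

section \<open>Isotropic Gaussian vectors\<close>

text \<open>The law \<open>N(0, v Id)\<close>. It is described by characteristic functions rather than by a density because
  these also cover the point mass at \<open>v = 0\<close> and turn independent sums into products.\<close>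

definition isotropic_gaussian :: "'w measure \<Rightarrow> real \<Rightarrow> ('w \<Rightarrow> 'a::euclidean_space) \<Rightarrow> bool" where
  "isotropic_gaussian M v Z \<longleftrightarrow> 0 \<le> v \<and> Z \<in> borel_measurable M \<and>
     (\<forall>u t. char (distr M borel (\<lambda>\<omega>. u \<bullet> Z \<omega>)) t = complex_of_real (exp (- (v * (norm u * t)\<^sup>2) / 2)))"

lemma borel_measurable_vec_nth [measurable]:
  "(\<lambda>x::real ^ 'n. x $ i) \<in> borel_measurable borel"
  by (intro borel_measurable_continuous_onI continuous_intros)

context prob_space begin

lemma char_distr_scale:
  assumes "X \<in> borel_measurable M"
  shows "char (distr M borel (\<lambda>\<omega>. c * X \<omega>)) t = char (distr M borel X) (c * t)"
  using assms by (simp add: char_def integral_distr ac_simps)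

text \<open>The density is a product over the coordinates, so by Tonelli's theorem the mass of a box is a
  product as well. Both the marginals and the independence of the coordinates are read off from this.\<close>

lemma emeasure_std_normal_vector_box:
  fixes \<xi> :: "'a \<Rightarrow> real ^ 'n"
  assumes "std_normal_vector M \<xi>" and B: "\<And>i. B i \<in> sets borel"
  shows "emeasure M {\<omega>\<in>space M. \<forall>i. \<xi> \<omega> $ i \<in> B i} = (\<Prod>i\<in>UNIV. emeasure std_normal_distribution (B i))"
proof -
  have D: "distributed M lborel \<xi> (\<lambda>x. ennreal (\<Prod>i\<in>UNIV. std_normal_density (x $ i)))"
    using assms(1) by (simp add: std_normal_vector_def)
  have [measurable]: "B i \<in> sets borel" for i by (rule B)
  \<comment> \<open>Lebesgue measure on vectors factors over the basis; the basis vectors are the axes.\<close>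
  have inj: "inj (\<lambda>i::'n. axis i (1::real))"
    by (auto simp: inj_def axis_eq_axis)
  have Basis: "Basis = range (\<lambda>i::'n. axis i (1::real))"
    by (auto simp: Basis_vec_def)
  let ?f = "\<lambda>i x. ennreal (std_normal_density x) * indicator (B i) x"
  let ?j = "inv (\<lambda>i::'n. axis i (1::real))"
  have j: "?j (axis i 1) = i" for i by (rule inv_f_f[OF inj])
  have "{x::real^'n. \<forall>i. x $ i \<in> B i} = {x \<in> space borel. \<forall>i\<in>UNIV. x $ i \<in> B i}" by auto
  also have "\<dots> \<in> sets borel" by measurable
  finally have S: "{x::real^'n. \<forall>i. x $ i \<in> B i} \<in> sets lborel" by simp
  have "emeasure M {\<omega>\<in>space M. \<forall>i. \<xi> \<omega> $ i \<in> B i} = emeasure M (\<xi> -` {x. \<forall>i. x $ i \<in> B i} \<inter> space M)"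
    by (rule arg_cong[where f = "emeasure M"]) auto
  also have "\<dots> = (\<integral>\<^sup>+x. ennreal (\<Prod>i\<in>UNIV. std_normal_density (x $ i)) * indicator {x. \<forall>i. x $ i \<in> B i} x \<partial>lborel)"
    by (rule distributed_emeasure[OF D S])
  also have "\<dots> = (\<integral>\<^sup>+x. (\<Prod>i\<in>UNIV. ?f i (x $ i)) \<partial>lborel)"
  proof (intro nn_integral_cong)
    fix x :: "real ^ 'n"
    have "indicator {x. \<forall>i. x $ i \<in> B i} x = (\<Prod>i\<in>UNIV. indicator (B i) (x $ i) :: ennreal)"
      by (auto simp: indicator_def prod_zero_iff)
    then show "ennreal (\<Prod>i\<in>UNIV. std_normal_density (x $ i)) * indicator {x. \<forall>i. x $ i \<in> B i} x
        = (\<Prod>i\<in>UNIV. ?f i (x $ i))"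
      by (simp add: prod.distrib prod_ennreal)
  qed
  also have "\<dots> = (\<integral>\<^sup>+x. (\<Prod>b\<in>Basis. ?f (?j b) (x \<bullet> b)) \<partial>(lborel :: (real ^ 'n) measure))"
    unfolding Basis by (simp add: prod.reindex inj j inner_axis)
  also have "\<dots> = (\<Prod>b\<in>(Basis :: (real ^ 'n) set). \<integral>\<^sup>+x. ?f (?j b) x \<partial>lborel)"
    by (intro nn_integral_lborel_prod borel_measurable_times_ennreal borel_measurable_indicator B) auto
  also have "\<dots> = (\<Prod>i\<in>UNIV. \<integral>\<^sup>+x. ?f i x \<partial>lborel)"
    unfolding Basis by (simp add: prod.reindex inj j)
  also have "\<dots> = (\<Prod>i\<in>UNIV. emeasure std_normal_distribution (B i))"
    by (simp add: emeasure_density)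
  finally show ?thesis .
qed

lemma std_normal_vector_measurable:
  "std_normal_vector M \<xi> \<Longrightarrow> \<xi> \<in> borel_measurable M"
  by (auto simp: std_normal_vector_def dest: distributed_measurable)

lemma std_normal_vector_component:
  assumes "std_normal_vector M \<xi>"
  shows "distr M borel (\<lambda>\<omega>. \<xi> \<omega> $ i) = std_normal_distribution"
proof (rule measure_eqI)
  interpret N: prob_space std_normal_distribution by (rule prob_space_normal_density) simp
  have [measurable]: "(\<lambda>\<omega>. \<xi> \<omega> $ i) \<in> borel_measurable M"
    by (rule measurable_compose[OF std_normal_vector_measurable[OF assms] borel_measurable_vec_nth])
  fix A :: "real set" assume "A \<in> sets (distr M borel (\<lambda>\<omega>. \<xi> \<omega> $ i))"
  then have [measurable]: "A \<in> sets borel" by simp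
  let ?B = "\<lambda>j. if j = i then A else UNIV"
  have "emeasure (distr M borel (\<lambda>\<omega>. \<xi> \<omega> $ i)) A = emeasure M {\<omega>\<in>space M. \<forall>j. \<xi> \<omega> $ j \<in> ?B j}"
    by (auto simp: emeasure_distr intro!: arg_cong[where f = "emeasure M"])
  also have "\<dots> = (\<Prod>j\<in>UNIV. emeasure std_normal_distribution (?B j))"
    by (rule emeasure_std_normal_vector_box[OF assms]) auto
  also have "\<dots> = (\<Prod>j\<in>UNIV. if j = i then emeasure std_normal_distribution A else 1)"
    using N.emeasure_space_1 by (intro prod.cong) auto
  also have "\<dots> = emeasure std_normal_distribution A" by simp
  finally show "emeasure (distr M borel (\<lambda>\<omega>. \<xi> \<omega> $ i)) A = emeasure std_normal_distribution A" .
qed simp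

lemma std_normal_vector_indep_components:
  assumes "std_normal_vector M \<xi>"
  shows "indep_vars (\<lambda>_. borel) (\<lambda>i \<omega>. \<xi> \<omega> $ i) UNIV"
proof (subst indep_vars_finite[where E = "\<lambda>_. sets borel"], goal_cases)
  case 8
  have [measurable]: "(\<lambda>\<omega>. \<xi> \<omega> $ i) \<in> borel_measurable M" for i
    by (rule measurable_compose[OF std_normal_vector_measurable[OF assms] borel_measurable_vec_nth])
  have marg: "emeasure std_normal_distribution A = emeasure M ((\<lambda>\<omega>. \<xi> \<omega> $ i) -` A \<inter> space M)"
    if "A \<in> sets borel" for A i
    using that by (simp add: std_normal_vector_component[OF assms, of i, symmetric] emeasure_distr)
  show ?case
  proof
    fix A :: "'b \<Rightarrow> real set" assume "A \<in> UNIV \<rightarrow> sets borel"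
    then have A: "A i \<in> sets borel" for i by auto
    have "(\<Inter>j. (\<lambda>\<omega>. \<xi> \<omega> $ j) -` A j \<inter> space M) = {\<omega>\<in>space M. \<forall>i. \<xi> \<omega> $ i \<in> A i}" by auto
    then have "ennreal (prob (\<Inter>j. (\<lambda>\<omega>. \<xi> \<omega> $ j) -` A j \<inter> space M))
        = (\<Prod>j\<in>UNIV. ennreal (prob ((\<lambda>\<omega>. \<xi> \<omega> $ j) -` A j \<inter> space M)))"
      using emeasure_std_normal_vector_box[OF assms A] marg[OF A]
      by (simp add: emeasure_eq_measure)
    then show "prob (\<Inter>j. (\<lambda>\<omega>. \<xi> \<omega> $ j) -` A j \<inter> space M) = (\<Prod>j\<in>UNIV. prob ((\<lambda>\<omega>. \<xi> \<omega> $ j) -` A j \<inter> space M))"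
      by (simp add: prod_ennreal prod_nonneg)
  qed
qed (use std_normal_vector_measurable[OF assms] in \<open>auto simp: Int_stable_def sets.sigma_sets_eq[of borel, simplified]\<close>)

text \<open>The projection on \<open>u\<close> is the sum of the independent variables \<open>u\<^sub>i \<xi>\<^sub>i\<close>, so its characteristic
  function is a product of Gaussian factors, whose exponents add up to \<open>- (norm u * t)\<^sup>2 / 2\<close>.\<close>

lemma std_normal_vector_isotropic:
  fixes \<xi> :: "'a \<Rightarrow> real ^ 'n"
  assumes "std_normal_vector M \<xi>"
  shows "isotropic_gaussian M 1 \<xi>"
proof -
  have [measurable]: "\<xi> \<in> borel_measurable M" by (rule std_normal_vector_measurable[OF assms])
  have [measurable]: "(\<lambda>\<omega>. \<xi> \<omega> $ i) \<in> borel_measurable M" for i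
    by (rule measurable_compose[OF std_normal_vector_measurable[OF assms] borel_measurable_vec_nth])
  have "char (distr M borel (\<lambda>\<omega>. u \<bullet> \<xi> \<omega>)) t = exp (- (norm u * t)\<^sup>2 / 2)" for u t
  proof -
    have ind: "indep_vars (\<lambda>_. borel) (\<lambda>i \<omega>. u $ i * \<xi> \<omega> $ i) UNIV"
      by (rule indep_vars_compose2[OF std_normal_vector_indep_components[OF assms]]) simp
    have "(\<lambda>\<omega>. u \<bullet> \<xi> \<omega>) = (\<lambda>\<omega>. \<Sum>i\<in>UNIV. u $ i * \<xi> \<omega> $ i)"
      by (simp add: inner_vec_def)
    then have "char (distr M borel (\<lambda>\<omega>. u \<bullet> \<xi> \<omega>)) t
        = (\<Prod>i\<in>UNIV. char (distr M borel (\<lambda>\<omega>. u $ i * \<xi> \<omega> $ i)) t)"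
      by (simp add: char_distr_sum[OF ind])
    also have "\<dots> = (\<Prod>i\<in>UNIV. complex_of_real (exp (- (u $ i * t)\<^sup>2 / 2)))"
      by (simp add: char_distr_scale std_normal_vector_component[OF assms] char_std_normal_distribution)
    also have "\<dots> = exp (\<Sum>i\<in>UNIV. - (u $ i * t)\<^sup>2 / 2)"
      by (simp add: exp_sum flip: of_real_prod)
    also have "(\<Sum>i\<in>UNIV. - (u $ i * t)\<^sup>2 / 2) = - (norm u * t)\<^sup>2 / 2"
      by (simp add: norm_vec_def L2_set_def real_sqrt_pow2 sum_nonneg power_mult_distrib sum_negf sum_distrib_right sum_divide_distrib)
    finally show ?thesis .
  qed
  then show ?thesis by (simp add: isotropic_gaussian_def)
qed

lemma isotropic_gaussian_zero:
  assumes "\<And>\<omega>. \<omega> \<in> space M \<Longrightarrow> Z \<omega> = 0"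
  shows "isotropic_gaussian M 0 Z"
proof -
  have [measurable]: "Z \<in> borel_measurable M"
    by (subst measurable_cong[where g = "\<lambda>_. 0"]) (auto simp: assms)
  have "char (distr M borel (\<lambda>\<omega>. u \<bullet> Z \<omega>)) t = 1" for u t
  proof -
    have "char (distr M borel (\<lambda>\<omega>. u \<bullet> Z \<omega>)) t = (CLINT \<omega>|M. iexp (t * (u \<bullet> Z \<omega>)))"
      by (simp add: char_def integral_distr)
    also have "\<dots> = (CLINT \<omega>|M. 1)"
      by (intro Bochner_Integration.integral_cong) (auto simp: assms)
    finally show ?thesis by (simp add: prob_space)
  qed
  then show ?thesis by (simp add: isotropic_gaussian_def)
qed

lemma isotropic_gaussian_cong:
  assumes "isotropic_gaussian M v Z" and eq: "\<And>\<omega>. \<omega> \<in> space M \<Longrightarrow> Z \<omega> = Z' \<omega>"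
  shows "isotropic_gaussian M v Z'"
proof -
  have "Z \<in> borel_measurable M \<longleftrightarrow> Z' \<in> borel_measurable M"
    using eq by (rule measurable_cong)
  moreover have "distr M borel (\<lambda>\<omega>. u \<bullet> Z \<omega>) = distr M borel (\<lambda>\<omega>. u \<bullet> Z' \<omega>)" for u
    by (intro distr_cong) (auto simp: eq)
  ultimately show ?thesis using assms(1) by (simp add: isotropic_gaussian_def)
qed

lemma isotropic_gaussian_scaleR:
  assumes "isotropic_gaussian M v Z"
  shows "isotropic_gaussian M (c\<^sup>2 * v) (\<lambda>\<omega>. c *\<^sub>R Z \<omega>)"
proof -
  have [measurable]: "Z \<in> borel_measurable M" using assms by (simp add: isotropic_gaussian_def)
  show ?thesis
    using assms by (auto simp: isotropic_gaussian_def char_distr_scale power_mult_distrib ac_simps)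
qed

lemma isotropic_gaussian_add:
  fixes Z W :: "'a \<Rightarrow> 'b::euclidean_space"
  assumes "isotropic_gaussian M v Z" "isotropic_gaussian M w W" and ind: "indep_var borel Z borel W"
  shows "isotropic_gaussian M (v + w) (\<lambda>\<omega>. Z \<omega> + W \<omega>)"
proof -
  have [measurable]: "Z \<in> borel_measurable M" "W \<in> borel_measurable M"
    using assms by (auto simp: isotropic_gaussian_def)
  have "char (distr M borel (\<lambda>\<omega>. u \<bullet> (Z \<omega> + W \<omega>))) t
      = complex_of_real (exp (- ((v + w) * (norm u * t)\<^sup>2) / 2))" for u t
  proof -
    have "indep_var borel ((\<bullet>) u \<circ> Z) borel ((\<bullet>) u \<circ> W)"
      by (rule indep_var_compose[OF ind]) simp_all
    from char_distr_add[OF this, of t] show ?thesis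
      using assms
      by (simp add: isotropic_gaussian_def inner_add_right comp_def mult_exp_exp
          add_divide_distrib diff_divide_distrib algebra_simps flip: of_real_mult exp_add)
  qed
  with assms show ?thesis by (simp add: isotropic_gaussian_def)
qed

text \<open>By Levy's uniqueness theorem. Writing the law as the image of the standard normal law under
  scaling treats the degenerate cases \<open>v = 0\<close> and \<open>u = 0\<close> like all others.\<close>

lemma isotropic_gaussian_law:
  assumes "isotropic_gaussian M v Z"
  shows "distr M borel (\<lambda>\<omega>. u \<bullet> Z \<omega>) = distr std_normal_distribution borel (\<lambda>x. sqrt v * norm u * x)"
proof (rule Levy_uniqueness)
  interpret N: prob_space std_normal_distribution by (rule prob_space_normal_density) simp
  have [measurable]: "Z \<in> borel_measurable M" using assms by (simp add: isotropic_gaussian_def)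
  show "real_distribution (distr M borel (\<lambda>\<omega>. u \<bullet> Z \<omega>))" by simp
  show "real_distribution (distr std_normal_distribution borel (\<lambda>x. sqrt v * norm u * x))" by simp
  show "char (distr M borel (\<lambda>\<omega>. u \<bullet> Z \<omega>)) = char (distr std_normal_distribution borel (\<lambda>x. sqrt v * norm u * x))"
  proof
    fix t
    have "char (distr std_normal_distribution borel (\<lambda>x. sqrt v * norm u * x)) t
        = char (distr std_normal_distribution borel (\<lambda>x. x)) (sqrt v * norm u * t)"
      by (rule N.char_distr_scale) simp
    also have "distr std_normal_distribution borel (\<lambda>x. x) = std_normal_distribution"
      by (rule distr_id2) simp
    finally show "char (distr M borel (\<lambda>\<omega>. u \<bullet> Z \<omega>)) t
        = char (distr std_normal_distribution borel (\<lambda>x. sqrt v * norm u * x)) t"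
      using assms by (simp add: isotropic_gaussian_def char_std_normal_distribution power_mult_distrib)
  qed
qed

lemma isotropic_gaussian_gaussian_vector:
  fixes Z :: "'a \<Rightarrow> 'b::euclidean_space"
  assumes "isotropic_gaussian M v Z"
  shows "gaussian_vector M Z"
  unfolding gaussian_vector_def
proof (intro conjI allI)
  show "Z \<in> borel_measurable M" using assms by (simp add: isotropic_gaussian_def)
  fix u :: 'b
  interpret N: prob_space std_normal_distribution by (rule prob_space_normal_density) simp
  define s where "s = sqrt v * norm u"
  have s: "0 \<le> s" using assms by (simp add: s_def isotropic_gaussian_def)
  have "distr std_normal_distribution borel (\<lambda>x. s * x) = 
    (if s = 0 then return borel 0 else density lborel (\<lambda>x. ennreal (normal_density 0 s x)))"
  proof (cases "s = 0")
    case True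
    then show ?thesis using N.prob_space_axioms by (simp add: N.distr_const)
  next
    case False
    have "distr std_normal_distribution lborel (\<lambda>x. x) = std_normal_distribution"
      by (rule distr_id2) simp
    then have "distributed std_normal_distribution lborel (\<lambda>x. x) (\<lambda>x. ennreal (std_normal_density x))"
      by (simp add: distributed_def)
    from N.normal_density_affine[OF this, of s 0] False s
    have "distributed std_normal_distribution lborel (\<lambda>x. s * x) (\<lambda>x. ennreal (normal_density 0 s x))"
      by simp
    from distributed_distr_eq_density[OF this] False show ?thesis
      by (simp cong: distr_cong)
  qed
  then have "distr M borel (\<lambda>\<omega>. u \<bullet> Z \<omega>) = 
    (if s = 0 then return borel 0 else density lborel (\<lambda>x. ennreal (normal_density 0 s x)))"
    using isotropic_gaussian_law[OF assms, of u] by (simp add: s_def)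
  with s show "\<exists>m s. 0 \<le> s \<and> distr M borel (\<lambda>\<omega>. u \<bullet> Z \<omega>) = 
    (if s = 0 then return borel m else density lborel (\<lambda>x. ennreal (normal_density m s x)))"
    by blast
qed

text \<open>Reduces moments of projections to one-dimensional integrals against the standard normal density.\<close>

lemma isotropic_gaussian_integral:
  assumes "isotropic_gaussian M v Z" and f: "f \<in> borel_measurable borel"
    and "has_bochner_integral lborel (\<lambda>x. std_normal_density x * f (sqrt v * norm u * x)) (c::real)"
  shows "has_bochner_integral M (\<lambda>\<omega>. f (u \<bullet> Z \<omega>)) c"
proof -
  note [measurable] = f
  have [measurable]: "Z \<in> borel_measurable M" using assms by (simp add: isotropic_gaussian_def)
  have "has_bochner_integral std_normal_distribution (\<lambda>x. f (sqrt v * norm u * x)) c"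
    using assms(3) by (intro has_bochner_integral_density) auto
  then have "has_bochner_integral (distr std_normal_distribution borel (\<lambda>x. sqrt v * norm u * x)) f c"
    by (simp add: has_bochner_integral_iff integrable_distr_eq integral_distr)
  then have "has_bochner_integral (distr M borel (\<lambda>\<omega>. u \<bullet> Z \<omega>)) f c"
    by (simp add: isotropic_gaussian_law[OF assms(1)])
  then show ?thesis
    by (simp add: has_bochner_integral_iff integrable_distr_eq integral_distr)
qed

lemma isotropic_gaussian_mean:
  assumes "isotropic_gaussian M v Z"
  shows "has_bochner_integral M Z 0"
proof -
  have "has_bochner_integral M (\<lambda>\<omega>. b \<bullet> Z \<omega>) 0" for b
  proof (rule isotropic_gaussian_integral[OF assms, of "\<lambda>x. x"])
    have "has_bochner_integral lborel (\<lambda>x. sqrt v * norm b * (std_normal_density x * x ^ (2 * 0 + 1))) (sqrt v * norm b * 0)"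
      by (intro has_bochner_integral_mult_right std_normal_moment_odd)
    then show "has_bochner_integral lborel (\<lambda>x. std_normal_density x * (sqrt v * norm b * x)) 0"
      by (simp add: ac_simps)
  qed simp
  then have "has_bochner_integral M (\<lambda>\<omega>. \<Sum>b\<in>Basis. (b \<bullet> Z \<omega>) *\<^sub>R b) (\<Sum>b\<in>Basis. 0 *\<^sub>R b)"
    by (intro has_bochner_integral_sum has_bochner_integral_scaleR_left)
  then show ?thesis by (simp add: inner_commute[of _ "Z _"] euclidean_representation)
qed

text \<open>The diagonal case \<open>u = w\<close> is the second moment of a normal variable; the general case follows by
  polarisation.\<close>

lemma isotropic_gaussian_second_moment:
  assumes "isotropic_gaussian M v Z"
  shows "has_bochner_integral M (\<lambda>\<omega>. (u \<bullet> Z \<omega>) * (w \<bullet> Z \<omega>)) (v * (u \<bullet> w))"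
proof -
  have sq: "has_bochner_integral M (\<lambda>\<omega>. (b \<bullet> Z \<omega>)\<^sup>2) (v * (b \<bullet> b))" for b
  proof (rule isotropic_gaussian_integral[OF assms, of "\<lambda>x. x\<^sup>2"])
    have "has_bochner_integral lborel (\<lambda>x. (sqrt v * norm b)\<^sup>2 * (std_normal_density x * x ^ (2 * 1)))
        ((sqrt v * norm b)\<^sup>2 * (fact (2 * 1) / (2 ^ 1 * fact 1)))"
      by (intro has_bochner_integral_mult_right std_normal_moment_even)
    then show "has_bochner_integral lborel (\<lambda>x. std_normal_density x * (sqrt v * norm b * x)\<^sup>2) (v * (b \<bullet> b))"
      using assms by (simp add: isotropic_gaussian_def power_mult_distrib power2_norm_eq_inner) (simp add: power2_eq_square ac_simps)
  qed simp
  have "has_bochner_integral M (\<lambda>\<omega>. (((u + w) \<bullet> Z \<omega>)\<^sup>2 - (u \<bullet> Z \<omega>)\<^sup>2 - (w \<bullet> Z \<omega>)\<^sup>2) / 2)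
      ((v * ((u + w) \<bullet> (u + w)) - v * (u \<bullet> u) - v * (w \<bullet> w)) / 2)"
    by (intro has_bochner_integral_divide_zero has_bochner_integral_diff sq)
  then show ?thesis
    by (simp add: inner_add_left inner_add_right inner_commute[of w u] power2_eq_square algebra_simps)
qed

lemma isotropic_gaussian_covariance:
  fixes Z :: "'a \<Rightarrow> real ^ 'n"
  assumes "isotropic_gaussian M v Z"
  shows "has_bochner_integral M (\<lambda>\<omega>. (\<chi> i j. Z \<omega> $ i * Z \<omega> $ j) :: real ^ 'n ^ 'n) (v *\<^sub>R mat 1)"
proof -
  \<comment> \<open>A matrix is the sum of its entries times matrix units, so it is integrated entry by entry.\<close>
  let ?E = "\<lambda>i j. axis i (axis j 1) :: real ^ 'n ^ 'n"
  have sum_if: "(\<Sum>j\<in>UNIV. if P then g j else 0) = (if P then \<Sum>j\<in>UNIV. g j else 0)" for P and g :: "'n \<Rightarrow> real"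
    by simp
  have entries: "(\<chi> i j. f i j) = (\<Sum>i\<in>UNIV. \<Sum>j\<in>UNIV. f i j *\<^sub>R ?E i j)" for f :: "'n \<Rightarrow> 'n \<Rightarrow> real"
    by (simp add: vec_eq_iff axis_def if_distrib[where f = "\<lambda>x. _ * x"] if_distrib[where f = "\<lambda>x. x $ _"] sum_if cong: if_cong)
  have "has_bochner_integral M (\<lambda>\<omega>. Z \<omega> $ i * Z \<omega> $ j) (if i = j then v else 0)" for i j
    using isotropic_gaussian_second_moment[OF assms, of "axis i 1" "axis j 1"]
    by (simp add: inner_axis', simp add: axis_def split: if_splits)
  then have "has_bochner_integral M (\<lambda>\<omega>. \<Sum>i\<in>UNIV. \<Sum>j\<in>UNIV. (Z \<omega> $ i * Z \<omega> $ j) *\<^sub>R ?E i j)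
      (\<Sum>i\<in>UNIV. \<Sum>j\<in>UNIV. (if i = j then v else 0) *\<^sub>R ?E i j)"
    by (intro has_bochner_integral_sum has_bochner_integral_scaleR_left)
  then have "has_bochner_integral M (\<lambda>\<omega>. (\<chi> i j. Z \<omega> $ i * Z \<omega> $ j) :: real ^ 'n ^ 'n) (\<chi> i j. if i = j then v else 0)"
    unfolding entries .
  also have "(\<chi> i j. if i = j then v else 0) = v *\<^sub>R (mat 1 :: real ^ 'n ^ 'n)"
    by (simp add: mat_def vec_eq_iff)
  finally show ?thesis .
qed

end

section \<open>Elimination of the velocities\<close>

lemma obabo_three_term_recursion:
  fixes x :: "int \<Rightarrow> 'a::real_vector" and v :: "nat \<Rightarrow> 'a" and h \<gamma> :: real
  defines "r \<equiv> exp (- \<gamma> * h / 2)"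
  defines "\<sigma> \<equiv> sqrt (1 - r\<^sup>2)"
  assumes h: "h \<noteq> 0"
    and step: "\<And>k. (x (int (Suc k)), v (Suc k)) = obabo_step g h \<gamma> (\<xi>1 (Suc k), \<xi>2 (Suc k)) (x (int k), v k)"
    and aux: "v 0 = r *\<^sub>R ((x 0 - x (-1)) /\<^sub>R h - (h / 2) *\<^sub>R g (x 0)) + \<sigma> *\<^sub>R \<xi>2 0"
  shows "x (int k + 1) = x (int k) + r\<^sup>2 *\<^sub>R (x (int k) - x (int k - 1))
    - (h\<^sup>2 / 2 * (1 + r\<^sup>2)) *\<^sub>R g (x (int k)) + (h * \<sigma>) *\<^sub>R (r *\<^sub>R \<xi>2 k + \<xi>1 (Suc k))"
proof -
  \<comment> \<open>\<open>b k\<close> is the velocity at which the position drifts in step \<open>k + 1\<close>.\<close>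
  define b where "b k = r *\<^sub>R v k + \<sigma> *\<^sub>R \<xi>1 (Suc k) - (h / 2) *\<^sub>R g (x (int k))" for k
  have x_step: "x (int k + 1) = x (int k) + h *\<^sub>R b k"
    and v_step: "v (Suc k) = r *\<^sub>R (b k - (h / 2) *\<^sub>R g (x (int k + 1))) + \<sigma> *\<^sub>R \<xi>2 (Suc k)" for k
    using step[of k] by (simp_all add: obabo_step_def Let_def b_def r_def \<sigma>_def add.commute)
  have v_eq: "v k = r *\<^sub>R ((x (int k) - x (int k - 1)) /\<^sub>R h - (h / 2) *\<^sub>R g (x (int k))) + \<sigma> *\<^sub>R \<xi>2 k" for k
  proof (cases k)
    case 0
    then show ?thesis using aux by simp
  next
    case (Suc m)
    have "b m = (x (int m + 1) - x (int m)) /\<^sub>R h"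
      using x_step[of m] h by simp
    then show ?thesis
      using v_step[of m] Suc by (simp add: add.commute)
  qed
  \<comment> \<open>The factor \<open>h * inverse h\<close> stays explicit so that the identity is polynomial.\<close>
  have "h *\<^sub>R b k = (r\<^sup>2 * (h * inverse h)) *\<^sub>R (x (int k) - x (int k - 1))
      - (h\<^sup>2 / 2 * (1 + r\<^sup>2)) *\<^sub>R g (x (int k)) + (h * \<sigma>) *\<^sub>R (r *\<^sub>R \<xi>2 k + \<xi>1 (Suc k))"
    unfolding b_def v_eq by (simp add: algebra_simps power2_eq_square add_divide_distrib)
  with h show ?thesis by (simp add: x_step)
qed

section \<open>The noise of the position recursion\<close>

context prob_space begin

text \<open>The index \<open>(k, True)\<close> stands for \<open>\<xi>1 k\<close> and \<open>(k, False)\<close> for \<open>\<xi>2 k\<close>. Of the two noises with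
  number 0 only \<open>\<xi>2 0\<close> belongs to the family.\<close>

lemma noise_family_independent:
  fixes \<xi>1 \<xi>2 :: "nat \<Rightarrow> 'a \<Rightarrow> 'b::euclidean_space"
  assumes within: "\<And>k. k \<ge> 1 \<Longrightarrow> indep_var borel (\<xi>1 k) borel (\<xi>2 k)"
    and pairs: "indep_vars (\<lambda>_. borel) (\<lambda>k \<omega>. (\<xi>1 k \<omega>, \<xi>2 k \<omega>)) {1..}"
    and rv0: "\<xi>2 0 \<in> borel_measurable M"
    and initial: "indep_set (sets (vimage_algebra (space M) (\<xi>2 0) borel))
      (sets (vimage_algebra (space M) (\<lambda>\<omega>. \<lambda>k\<in>{1..}. (\<xi>1 k \<omega>, \<xi>2 k \<omega>)) (\<Pi>\<^sub>M k\<in>{1..}. borel)))"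
  shows "indep_vars (\<lambda>_. borel) (\<lambda>(k, b) \<omega>. if b then \<xi>1 k \<omega> else \<xi>2 k \<omega>)
    (insert (0, False) ({1..} \<times> UNIV))"
proof (rule indep_vars_insert)
  let ?noise = "\<lambda>(k, b) \<omega>. if b then \<xi>1 k \<omega> else \<xi>2 k \<omega>"
  let ?I = "{1..} \<times> UNIV :: (nat \<times> bool) set"
  let ?W = "\<lambda>\<omega>. \<lambda>k\<in>{1..}. (\<xi>1 k \<omega>, \<xi>2 k \<omega>)"
  let ?P = "\<Pi>\<^sub>M k\<in>{1..}. borel :: ('b \<times> 'b) measure"
  let ?VW = "vimage_algebra (space M) ?W ?P"
  show "indep_vars (\<lambda>_. borel) ?noise ?I"
    using pairs by (intro indep_vars_split_pairs within) (auto simp: borel_prod)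
  show "(0, False) \<notin> ?I" by simp
  show "random_variable borel (?noise (0, False))" using rv0 by simp
  \<comment> \<open>The flattened family is a measurable function of the family of pairs, so it generates no more
    events than the pairs do.\<close>
  define flat where "flat f = (\<lambda>j\<in>?I. (if snd j then fst else snd) (f (fst j)))" for f :: "nat \<Rightarrow> 'b \<times> 'b"
  have "(\<lambda>f. (if snd j then fst else snd) (f (fst j))) \<in> borel_measurable ?P" if "j \<in> ?I" for j
    by (rule measurable_compose[OF measurable_component_singleton[of "fst j"]])
      (use that in \<open>auto simp flip: borel_prod\<close>)
  then have flat: "flat \<in> measurable ?P (\<Pi>\<^sub>M j\<in>?I. borel)"
    unfolding flat_def by (intro measurable_restrict)
  have "?W \<in> measurable ?VW ?P"
    by (rule measurable_vimage_algebra1) (auto simp: space_PiM)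
  from measurable_compose[OF this flat]
  have "(\<lambda>\<omega>. flat (?W \<omega>)) \<in> measurable ?VW (\<Pi>\<^sub>M j\<in>?I. borel)" .
  also have "(\<lambda>\<omega>. flat (?W \<omega>)) = (\<lambda>\<omega>. \<lambda>j\<in>?I. ?noise j \<omega>)"
    by (auto simp: flat_def fun_eq_iff)
  finally have "sets (vimage_algebra (space M) (\<lambda>\<omega>. \<lambda>j\<in>?I. ?noise j \<omega>) (\<Pi>\<^sub>M j\<in>?I. borel)) \<subseteq> sets ?VW"
    unfolding measurable_iff_sets space_vimage_algebra by (rule conjunct2)
  with initial show "indep_set (sets (vimage_algebra (space M) (?noise (0, False)) borel))
      (sets (vimage_algebra (space M) (\<lambda>\<omega>. \<lambda>j\<in>?I. ?noise j \<omega>) (\<Pi>\<^sub>M j\<in>?I. borel)))"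
    by (auto simp: indep_sets2_eq)
qed

lemma indep_var_of_indep_vars:
  assumes "indep_vars (\<lambda>_. N) X I" "i \<in> I" "j \<in> I" "i \<noteq> j"
  shows "indep_var N (X i) N (X j)"
proof -
  have "indep_var (PiM {i} (\<lambda>_. N)) (\<lambda>\<omega>. restrict (\<lambda>k. X k \<omega>) {i}) (PiM {j} (\<lambda>_. N)) (\<lambda>\<omega>. restrict (\<lambda>k. X k \<omega>) {j})"
    using assms by (intro indep_var_restrict[OF assms(1)]) auto
  from indep_var_compose[OF this, of "\<lambda>f. f i" N "\<lambda>f. f j" N] show ?thesis
    by (simp add: comp_def)
qed

text \<open>The blocks \<open>{(k, True), (k - 1, False)}\<close> are disjoint for distinct \<open>k \<ge> 1\<close>.\<close>

lemma shifted_combinations_independent: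
  fixes \<xi>1 \<xi>2 :: "nat \<Rightarrow> 'a \<Rightarrow> 'b::euclidean_space"
  assumes "indep_vars (\<lambda>_. borel) (\<lambda>(k, b) \<omega>. if b then \<xi>1 k \<omega> else \<xi>2 k \<omega>)
    (insert (0, False) ({1..} \<times> UNIV))"
  shows "indep_vars (\<lambda>_. borel) (\<lambda>k \<omega>. c *\<^sub>R (r *\<^sub>R \<xi>2 (k - 1) \<omega> + \<xi>1 k \<omega>)) {1..}"
proof -
  let ?noise = "\<lambda>(k, b) \<omega>. if b then \<xi>1 k \<omega> else \<xi>2 k \<omega>"
  let ?K = "\<lambda>k::nat. {(k, True), (k - 1, False)}"
  have "indep_vars (\<lambda>k. \<Pi>\<^sub>M j\<in>?K k. borel) (\<lambda>k \<omega>. \<lambda>j\<in>?K k. ?noise j \<omega>) {1..}"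
    by (rule indep_vars_restrict[OF assms]) (auto simp: disjoint_family_on_def)
  then have "indep_vars (\<lambda>_. borel)
      (\<lambda>k \<omega>. (\<lambda>f. c *\<^sub>R (r *\<^sub>R f (k - 1, False) + f (k, True))) (\<lambda>j\<in>?K k. ?noise j \<omega>)) {1..}"
    by (rule indep_vars_compose2) measurable
  then show ?thesis by simp
qed

text \<open>The right-hand side no longer mentions the two vectors, so all such combinations have the same law.\<close>

lemma distr_std_normal_combination:
  fixes \<xi> \<eta> :: "'a \<Rightarrow> real ^ 'n"
  assumes "std_normal_vector M \<xi>" "std_normal_vector M \<eta>" and ind: "indep_var borel \<xi> borel \<eta>"
  defines "D \<equiv> density lborel (\<lambda>x :: real ^ 'n. ennreal (\<Prod>i\<in>UNIV. std_normal_density (x $ i)))"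
  shows "distr M borel (\<lambda>\<omega>. c *\<^sub>R (r *\<^sub>R \<xi> \<omega> + \<eta> \<omega>)) = distr (D \<Otimes>\<^sub>M D) borel (\<lambda>(x, y). c *\<^sub>R (r *\<^sub>R x + y))"
proof -
  have [measurable]: "\<xi> \<in> borel_measurable M" "\<eta> \<in> borel_measurable M"
    using assms by (auto intro: std_normal_vector_measurable)
  have law: "distr M borel X = D" if "std_normal_vector M X" for X
    using that unfolding std_normal_vector_def D_def
    by (auto simp flip: distributed_distr_eq_density intro!: distr_cong)
  have "distr M borel (\<lambda>\<omega>. c *\<^sub>R (r *\<^sub>R \<xi> \<omega> + \<eta> \<omega>))
      = distr (distr M (borel \<Otimes>\<^sub>M borel) (\<lambda>\<omega>. (\<xi> \<omega>, \<eta> \<omega>))) borel (\<lambda>(x, y). c *\<^sub>R (r *\<^sub>R x + y))"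
    by (simp add: distr_distr comp_def)
  also have "distr M (borel \<Otimes>\<^sub>M borel) (\<lambda>\<omega>. (\<xi> \<omega>, \<eta> \<omega>)) = D \<Otimes>\<^sub>M D"
    using ind assms(1,2) by (simp add: indep_var_distribution_eq law)
  finally show ?thesis .
qed

end

theorem proposition2p1:
  fixes U :: "real ^ 'n \<Rightarrow> real"
    and gradU :: "real ^ 'n \<Rightarrow> real ^ 'n"
    and h \<gamma> r \<beta> \<sigma> s :: real
    and M :: "'w measure"
    and X :: "int \<Rightarrow> 'w \<Rightarrow> real ^ 'n"
    and V :: "nat \<Rightarrow> 'w \<Rightarrow> real ^ 'n"
    and \<xi>1 \<xi>2 \<zeta> :: "nat \<Rightarrow> 'w \<Rightarrow> real ^ 'n"
  defines "r \<equiv> exp (- \<gamma> * h / 2)"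
    and "\<beta> \<equiv> r\<^sup>2"
    and "\<sigma> \<equiv> sqrt (1 - \<beta>)"
    and "s \<equiv> h\<^sup>2 / 2 * (1 + \<beta>)"
  assumes gradient: "\<And>x. GDERIV U x :> gradU x"
    and strongly_convex: "strongly_convex U"
    and lipschitz: "\<exists>L. L-lipschitz_on UNIV gradU"
    and "h > 0" and "\<gamma> > 0"
    and "prob_space M"
    and noise_normal: "\<And>k. k \<ge> 1 \<Longrightarrow> std_normal_vector M (\<xi>1 k) \<and> std_normal_vector M (\<xi>2 k)"
    and noise_pair_indep: "\<And>k. k \<ge> 1 \<Longrightarrow> prob_space.indep_var M borel (\<xi>1 k) borel (\<xi>2 k)"
    and noise_pairs_indep:
      "prob_space.indep_vars M (\<lambda>_. borel) (\<lambda>k \<omega>. (\<xi>1 k \<omega>, \<xi>2 k \<omega>)) {1..}"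
    and initial_noise:
      "(std_normal_vector M (\<xi>2 0) \<and>
          prob_space.indep_set M
            (sets (vimage_algebra (space M) (\<xi>2 0) borel))
            (sets (vimage_algebra (space M) (\<lambda>\<omega>. \<lambda>k\<in>{1..}. (\<xi>1 k \<omega>, \<xi>2 k \<omega>))
              (\<Pi>\<^sub>M k\<in>{1..}. borel))))
        \<or> (\<forall>\<omega>\<in>space M. \<xi>2 0 \<omega> = 0)"
    and initial_measurable: "X 0 \<in> borel_measurable M" "V 0 \<in> borel_measurable M"
    and chain:
      "\<And>k \<omega>. \<omega> \<in> space M \<Longrightarrow>
         (X (int (Suc k)) \<omega>, V (Suc k) \<omega>) =
           obabo_step gradU h \<gamma> (\<xi>1 (Suc k) \<omega>, \<xi>2 (Suc k) \<omega>) (X (int k) \<omega>, V k \<omega>)"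
    and auxiliary:
      "\<And>\<omega>. \<omega> \<in> space M \<Longrightarrow>
         V 0 \<omega> = r *\<^sub>R ((X 0 \<omega> - X (-1) \<omega>) /\<^sub>R h - (h / 2) *\<^sub>R gradU (X 0 \<omega>)) + \<sigma> *\<^sub>R \<xi>2 0 \<omega>"
    and zeta:
      "\<And>k \<omega>. \<omega> \<in> space M \<Longrightarrow>
         \<zeta> (Suc k) \<omega> = (h * \<sigma>) *\<^sub>R (r *\<^sub>R \<xi>2 k \<omega> + \<xi>1 (Suc k) \<omega>)"
  shows
    "(\<forall>k::nat. \<forall>\<omega>\<in>space M.
        X (int k + 1) \<omega> =
          X (int k) \<omega> + \<beta> *\<^sub>R (X (int k) \<omega> - X (int k - 1) \<omega>)
            - s *\<^sub>R gradU (X (int k) \<omega>) + \<zeta> (Suc k) \<omega>)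
     \<and> prob_space.indep_vars M (\<lambda>_. borel) \<zeta> {1..}
     \<and> (\<forall>k\<ge>1. gaussian_vector M (\<zeta> k) \<and> has_bochner_integral M (\<zeta> k) 0)
     \<and> (std_normal_vector M (\<xi>2 0) \<longrightarrow>
          (\<forall>j\<ge>1. \<forall>k\<ge>1. distr M borel (\<zeta> j) = distr M borel (\<zeta> k))
          \<and> (\<forall>k\<ge>1. has_bochner_integral M (\<lambda>\<omega>. (\<chi> i j. \<zeta> k \<omega> $ i * \<zeta> k \<omega> $ j) :: real ^ 'n ^ 'n)
                      ((h\<^sup>2 * (1 - \<beta>\<^sup>2)) *\<^sub>R mat 1)))
     \<and> ((\<forall>\<omega>\<in>space M. \<xi>2 0 \<omega> = 0) \<longrightarrow>
          (\<forall>\<omega>\<in>space M. \<zeta> 1 \<omega> = (h * \<sigma>) *\<^sub>R \<xi>1 1 \<omega>)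
          \<and> has_bochner_integral M (\<lambda>\<omega>. (\<chi> i j. \<zeta> 1 \<omega> $ i * \<zeta> 1 \<omega> $ j) :: real ^ 'n ^ 'n)
              ((h\<^sup>2 * (1 - \<beta>)) *\<^sub>R mat 1)
          \<and> (\<forall>k\<ge>2. has_bochner_integral M (\<lambda>\<omega>. (\<chi> i j. \<zeta> k \<omega> $ i * \<zeta> k \<omega> $ j) :: real ^ 'n ^ 'n)
                      ((h\<^sup>2 * (1 - \<beta>\<^sup>2)) *\<^sub>R mat 1)))"
proof -
  interpret prob_space M by fact
  let ?Z = "\<lambda>k \<omega>. (h * \<sigma>) *\<^sub>R (r *\<^sub>R \<xi>2 (k - 1) \<omega> + \<xi>1 k \<omega>)"
  let ?noise = "\<lambda>(k, b) \<omega>. if b then \<xi>1 k \<omega> else \<xi>2 k \<omega>"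
  have zeta_eq: "\<zeta> k \<omega> = ?Z k \<omega>" if "k \<ge> 1" "\<omega> \<in> space M" for k \<omega>
    using zeta[of \<omega> "k - 1"] that by simp
  have "\<beta> < 1"
    using \<open>h > 0\<close> \<open>\<gamma> > 0\<close> by (simp add: \<beta>_def r_def power_less_one_iff)
  then have \<sigma>_sq: "\<sigma>\<^sup>2 = 1 - \<beta>" by (simp add: \<sigma>_def)
  have normal1: "std_normal_vector M (\<xi>1 k)" if "k \<ge> 1" for k
    using noise_normal that by blast
  have normal2: "std_normal_vector M (\<xi>2 k)" if "k \<ge> 1 \<or> std_normal_vector M (\<xi>2 0)" for k
    using noise_normal that by (cases k) auto

  \<comment> \<open>A vanishing initial noise is constant and hence independent of everything.\<close>
  have initial: "\<xi>2 0 \<in> borel_measurable M \<and> indep_set (sets (vimage_algebra (space M) (\<xi>2 0) borel))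
      (sets (vimage_algebra (space M) (\<lambda>\<omega>. \<lambda>k\<in>{1..}. (\<xi>1 k \<omega>, \<xi>2 k \<omega>)) (\<Pi>\<^sub>M k\<in>{1..}. borel)))"
    using initial_noise
  proof
    assume zero: "\<forall>\<omega>\<in>space M. \<xi>2 0 \<omega> = 0"
    have "(\<lambda>\<omega>. \<lambda>k\<in>{1..}. (\<xi>1 k \<omega>, \<xi>2 k \<omega>)) \<in> measurable M (\<Pi>\<^sub>M k\<in>{1..}. borel)"
      using noise_pairs_indep by (intro measurable_restrict) (auto simp: indep_vars_def)
    then have "sets (vimage_algebra (space M) (\<lambda>\<omega>. \<lambda>k\<in>{1..}. (\<xi>1 k \<omega>, \<xi>2 k \<omega>)) (\<Pi>\<^sub>M k\<in>{1..}. borel)) \<subseteq> events"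
      by (simp add: measurable_iff_sets)
    moreover have "\<xi>2 0 \<in> borel_measurable M"
      using isotropic_gaussian_zero[of "\<xi>2 0"] zero by (simp add: isotropic_gaussian_def)
    ultimately show ?thesis
      using zero by (auto intro: indep_set_vimage_const)
  qed (auto intro: std_normal_vector_measurable)
  have noises: "indep_vars (\<lambda>_. borel) ?noise (insert (0, False) ({1..} \<times> UNIV))"
    using initial by (intro noise_family_independent noise_pair_indep noise_pairs_indep) auto
  have ind: "indep_var borel (\<xi>2 (k - 1)) borel (\<xi>1 k)" if "k \<ge> 1" for k
    using indep_var_of_indep_vars[OF noises, of "(k - 1, False)" "(k, True)"] that by (cases "k = 1") auto
  have isotropic: "isotropic_gaussian M ((h * \<sigma>)\<^sup>2 * (r\<^sup>2 * v + 1)) (\<zeta> k)"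
    if k: "k \<ge> 1" and v: "isotropic_gaussian M v (\<xi>2 (k - 1))" for k v
  proof -
    have "indep_var borel ((\<lambda>x. r *\<^sub>R x) \<circ> \<xi>2 (k - 1)) borel ((\<lambda>x. x) \<circ> \<xi>1 k)"
      by (rule indep_var_compose[OF ind[OF k]]) simp_all
    then have "isotropic_gaussian M ((h * \<sigma>)\<^sup>2 * (r\<^sup>2 * v + 1)) (?Z k)"
      by (intro isotropic_gaussian_scaleR isotropic_gaussian_add v std_normal_vector_isotropic normal1 k)
        (simp add: comp_def)
    then show ?thesis
      by (rule isotropic_gaussian_cong) (use k in \<open>simp add: zeta_eq\<close>)
  qed
  have full_variance: "(h * \<sigma>)\<^sup>2 * (r\<^sup>2 * 1 + 1) = h\<^sup>2 * (1 - \<beta>\<^sup>2)"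
    by (simp add: power_mult_distrib \<sigma>_sq flip: \<beta>_def) (simp add: algebra_simps power2_eq_square)
  have full: "isotropic_gaussian M (h\<^sup>2 * (1 - \<beta>\<^sup>2)) (\<zeta> k)"
    if k: "k \<ge> 1" "k \<ge> 2 \<or> std_normal_vector M (\<xi>2 0)" for k
  proof -
    have "k - 1 \<ge> 1 \<or> std_normal_vector M (\<xi>2 0)" using k by auto
    then have "isotropic_gaussian M 1 (\<xi>2 (k - 1))"
      by (intro std_normal_vector_isotropic normal2)
    from isotropic[OF k(1) this] show ?thesis by (simp only: full_variance)
  qed
  have degenerate: "isotropic_gaussian M (h\<^sup>2 * (1 - \<beta>)) (\<zeta> 1)" if "\<forall>\<omega>\<in>space M. \<xi>2 0 \<omega> = 0"
    using isotropic[of 1 0] isotropic_gaussian_zero[of "\<xi>2 0"] that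
    by (simp add: power_mult_distrib \<sigma>_sq)

  have recursion: "X (int k + 1) \<omega> = X (int k) \<omega> + \<beta> *\<^sub>R (X (int k) \<omega> - X (int k - 1) \<omega>)
      - s *\<^sub>R gradU (X (int k) \<omega>) + \<zeta> (Suc k) \<omega>" if \<omega>: "\<omega> \<in> space M" for k \<omega>
    using obabo_three_term_recursion[of h "\<lambda>k. X k \<omega>" "\<lambda>k. V k \<omega>" gradU \<gamma> "\<lambda>k. \<xi>1 k \<omega>" "\<lambda>k. \<xi>2 k \<omega>" k]
      chain[OF \<omega>] auxiliary[OF \<omega>] \<open>h > 0\<close>
    by (simp add: zeta[OF \<omega>] s_def \<sigma>_def \<beta>_def r_def)
  have independent: "indep_vars (\<lambda>_. borel) \<zeta> {1..}"
    by (rule indep_vars_cong_space[OF shifted_combinations_independent[OF noises]])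
      (simp add: zeta_eq)
  have gaussian: "gaussian_vector M (\<zeta> k) \<and> has_bochner_integral M (\<zeta> k) 0" if "k \<ge> 1" for k
  proof -
    have "\<exists>v. isotropic_gaussian M v (\<zeta> k)"
    proof (cases "k \<ge> 2 \<or> std_normal_vector M (\<xi>2 0)")
      case True
      then show ?thesis using full that by blast
    next
      case False
      then have "k = 1" using that by simp
      then show ?thesis using False initial_noise degenerate by blast
    qed
    then show ?thesis
      using isotropic_gaussian_gaussian_vector isotropic_gaussian_mean by blast
  qed
  have identical: "distr M borel (\<zeta> j) = distr M borel (\<zeta> k)"
    if "std_normal_vector M (\<xi>2 0)" "j \<ge> 1" "k \<ge> 1" for j k
  proof -
    have "distr M borel (\<zeta> i) = distr M borel (?Z i)" if "i \<ge> 1" for i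
      using zeta_eq[OF that] by (intro distr_cong) auto
    then show ?thesis
      using that distr_std_normal_combination[OF normal2 normal1 ind] by simp
  qed
  have first: "\<zeta> 1 \<omega> = (h * \<sigma>) *\<^sub>R \<xi>1 1 \<omega>"
    if "\<forall>\<omega>\<in>space M. \<xi>2 0 \<omega> = 0" "\<omega> \<in> space M" for \<omega>
    using zeta_eq[of 1 \<omega>] that by simp
  show ?thesis
  proof (intro conjI allI ballI impI)
    fix k :: nat assume "k \<ge> 1"
    then show "gaussian_vector M (\<zeta> k)" "has_bochner_integral M (\<zeta> k) 0"
      using gaussian by blast+
  next
    fix k :: nat assume "k \<ge> 2"
    then show "has_bochner_integral M (\<lambda>\<omega>. (\<chi> i j. \<zeta> k \<omega> $ i * \<zeta> k \<omega> $ j) :: real ^ 'n ^ 'n)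
        ((h\<^sup>2 * (1 - \<beta>\<^sup>2)) *\<^sub>R mat 1)"
      by (intro isotropic_gaussian_covariance full) auto
  qed (rule recursion independent identical first isotropic_gaussian_covariance[OF full]
      isotropic_gaussian_covariance[OF degenerate]; blast)+
qed

end
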